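(* Let $d\ge 2$ be an integer. For every $\eta>0$ there exists a (deterministic) dense forest in $\mathbb{R}^{d}$ with a visibility function $W$ satisfying $$W(\epsilon)=O\left(\epsilon^{-(d-1)}\cdot\ln(\epsilon^{-1})\cdot\left(\ln\ln(\epsilon^{-1})\right)^{1+\eta}\right)\qquad\text{as }\epsilon\to0^{+}.$$
   Context: $\mathbb{R}^{+}$ denotes the positive reals; "decreasing" means non-increasing. $B_2(0,T)$ is the Euclidean ball of radius $T$ centred at the origin of $\mathbb{R}^d$, and $\mathrm{dist}$ is the Euclidean distance. A subset $Y\subseteq\mathbb{R}^{d}$ has finite density if there is $C>0$ with $\#(B_2(0,T)\cap Y)\le C\,T^d$ for every $T>0$. A set $\mathfrak{F}\subseteq\mathbb{R}^{d}$ is a dense forest with visibility function $W$ if $\mathfrak{F}$ has finite density and $W:(0,1)\to\mathbb{R}^{+}$ is a decreasing function tending to $+\infty$ as $\epsilon\to0^{+}$ such that for any $\epsilon\in(0,1)$ and any line segment $L\subseteq\mathbb{R}^{d}$ of length $W(\epsilon)$, there is a point $x\in\mathfrak{F}$ with $\mathrm{dist}(x,L)\le\epsilon$. The $O$-bound means: there exist $C>0$ and $\epsilon_0\in(0,e^{-1})$ such that $W(\epsilon)\le C\,\epsilon^{-(d-1)}\ln(\epsilon^{-1})(\ln\ln(\epsilon^{-1}))^{1+\eta}$ for all $\epsilon\in(0,\epsilon_0]$. "Deterministic" means that the set is specified without any random choice. *)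

theory Defs
  imports "HOL-Analysis.Analysis"
begin

text \<open>Finiteness is stated explicitly because \<open>card\<close> of an infinite set is \<open>0\<close>.
  Since the bound is required for every \<open>T > 0\<close>, it also forces \<open>Y\<close> to avoid the origin.\<close>

definition finite_density :: "(real ^ 'n) set \<Rightarrow> bool" where
  "finite_density Y \<longleftrightarrow>
     (\<exists>C>0. \<forall>T>0. finite (cball 0 T \<inter> Y) \<and> real (card (cball 0 T \<inter> Y)) \<le> C * T ^ CARD('n))"

text \<open>Only the values of \<open>W\<close> on the open interval \<open>(0, 1)\<close> are constrained.\<close>

definition dense_forest :: "(real ^ 'n) set \<Rightarrow> (real \<Rightarrow> real) \<Rightarrow> bool" where
  "dense_forest F W \<longleftrightarrow>
     finite_density F \<and>
     (\<forall>\<epsilon>\<in>{0<..<1}. W \<epsilon> > 0) \<and>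
     antimono_on {0<..<1} W \<and>
     filterlim W at_top (at_right 0) \<and>
     (\<forall>\<epsilon>\<in>{0<..<1}. \<forall>a b. dist a b = W \<epsilon> \<longrightarrow>
        (\<exists>x\<in>F. infdist x (closed_segment a b) \<le> \<epsilon>))"

end

theory Submission
  imports Defs "HOL-Real_Asymp.Real_Asymp"
begin

text \<open>For each coordinate \<open>i\<close> and each \<open>j\<close>, put a translate of \<open>\<int>\<^sup>d\<^sup>-\<^sup>1\<close> on every hyperplane
  \<open>x\<^sub>i = q\<^sub>j m\<close>, \<open>m \<noteq> 0\<close>, where \<open>q\<^sub>j = (j + 1)\<^bsup>1 + \<eta>\<^esup>\<close>. The densities sum to a multiple of
  \<open>\<Sum> 1 / q\<^sub>j < \<infinity>\<close>. A long segment crosses consecutive hyperplanes of its dominant coordinate in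
  points that form an arithmetic progression \<open>p + l v\<close> modulo \<open>1\<close>. With random translates, such a
  progression of length about \<open>2\<^bsup>k(d-1)\<^esup> E\<close> stays \<open>2\<^bsup>-k\<^esup>\<close>-far from all translates with probability
  \<open>exp (-c E)\<close>, while up to discretisation there are only \<open>exp (O(E))\<close> progressions for all scales
  \<open>k \<le> E\<close> together. Hence one choice of translates with \<open>E = 2\<^bsup>j+1\<^esup>\<close> serves all scales
  \<open>2\<^bsup>-k\<^esup>\<close> with \<open>2\<^sup>j \<le> k \<le> 2\<^bsup>j+1\<^esup>\<close>, and \<open>j\<close> is comparable to \<open>ln (ln (1 / \<epsilon>))\<close>.\<close>

text \<open>The method of conditional expectations: the sum is the expected number of unhit \<open>t\<close> for a
  uniformly random \<open>\<theta>\<close>.\<close>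
lemma exists_hitting_assignment:
  fixes A :: "'t \<Rightarrow> 'i \<Rightarrow> 'w set"
  assumes "finite I" "finite T" "finite \<Omega>" "\<Omega> \<noteq> {}"
    and "\<And>t h. A t h \<subseteq> \<Omega>"
    and "(\<Sum>t\<in>T. \<Prod>h\<in>I. 1 - real (card (A t h)) / real (card \<Omega>)) < 1"
  shows "\<exists>\<theta>. \<forall>t\<in>T. \<exists>h\<in>I. \<theta> h \<in> A t h"
  using assms(1,2,6)
proof (induction I arbitrary: T rule: finite_induct)
  case empty
  \<comment> \<open>The empty product is 1, so the sum is \<open>card T\<close> and the bound leaves
    no \<open>t\<close> at all.\<close>
  then show ?case by auto
next
  case (insert h I)
  define g where "g t = (\<Prod>h\<in>I. 1 - real (card (A t h)) / real (card \<Omega>))" for t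
  have cpos: "real (card \<Omega>) > 0" using assms(3,4) by (simp add: card_gt_0_iff)
  have sum_lt: "(\<Sum>t\<in>T. (1 - real (card (A t h)) / real (card \<Omega>)) * g t) < 1"
    using insert by (simp add: g_def)
  \<comment> \<open>Averaged over all values \<open>\<omega>\<close> at \<open>h\<close>, the
    restricted sum equals the current sum, which is below 1; hence some value keeps it below
    1.\<close>
  have "\<exists>\<omega>\<in>\<Omega>. (\<Sum>t\<in>{t\<in>T. \<omega> \<notin> A t h}. g t) < 1"
  proof (rule ccontr)
    assume "\<not> ?thesis"
    then have "\<And>\<omega>. \<omega> \<in> \<Omega> \<Longrightarrow> 1 \<le> (\<Sum>t\<in>{t\<in>T. \<omega> \<notin> A t h}. g t)" by force
    then have "real (card \<Omega>) * 1 \<le> (\<Sum>\<omega>\<in>\<Omega>. \<Sum>t\<in>{t\<in>T. \<omega> \<notin> A t h}. g t)"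
      by (intro sum_bounded_below) auto
    also have "\<dots> = (\<Sum>\<omega>\<in>\<Omega>. \<Sum>t\<in>T. if \<omega> \<notin> A t h then g t else 0)"
      using insert.prems(1) by (intro sum.cong refl sum.inter_filter)
    also have "\<dots> = (\<Sum>t\<in>T. \<Sum>\<omega>\<in>\<Omega>. if \<omega> \<notin> A t h then g t else 0)"
      by (rule sum.swap)
    also have "\<dots> = (\<Sum>t\<in>T. real (card \<Omega>) * ((1 - real (card (A t h)) / real (card \<Omega>)) * g t))"
    proof (rule sum.cong[OF refl])
      fix t
      have "(\<Sum>\<omega>\<in>\<Omega>. if \<omega> \<notin> A t h then g t else 0) = (\<Sum>\<omega>\<in>{\<omega>\<in>\<Omega>. \<omega> \<notin> A t h}. g t)"
        using assms(3) by (rule sum.inter_filter[symmetric])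
      also have "{\<omega>\<in>\<Omega>. \<omega> \<notin> A t h} = \<Omega> - A t h" by auto
      also have "(\<Sum>\<omega>\<in>\<Omega> - A t h. g t) = (real (card \<Omega>) - real (card (A t h))) * g t"
        using assms(3) assms(5)[of t h]
        by (simp add: card_Diff_subset finite_subset card_mono of_nat_diff)
      also have "\<dots> = real (card \<Omega>) * ((1 - real (card (A t h)) / real (card \<Omega>)) * g t)"
        using cpos by (simp add: field_simps)
      finally show "(\<Sum>\<omega>\<in>\<Omega>. if \<omega> \<notin> A t h then g t else 0)
          = real (card \<Omega>) * ((1 - real (card (A t h)) / real (card \<Omega>)) * g t)" .
    qed
    also have "\<dots> < real (card \<Omega>) * 1"
      unfolding sum_distrib_left[symmetric] using sum_lt cpos by (intro mult_strict_left_mono)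
    finally show False by simp
  qed
  then obtain \<omega> where \<omega>: "(\<Sum>t\<in>{t\<in>T. \<omega> \<notin> A t h}. g t) < 1" by blast
  with insert.IH[of "{t\<in>T. \<omega> \<notin> A t h}"] insert.prems(1)
  obtain \<theta> where \<theta>: "\<forall>t\<in>{t\<in>T. \<omega> \<notin> A t h}. \<exists>h\<in>I. \<theta> h \<in> A t h"
    by (auto simp: g_def)
  have "\<forall>t\<in>T. \<exists>h'\<in>insert h I. (\<theta>(h := \<omega>)) h' \<in> A t h'"
    using \<theta> insert.hyps(2) by fastforce
  then show ?case by blast
qed

subsection \<open>Shift sequences meeting all arithmetic progressions modulo one\<close>

definition cell :: "nat \<Rightarrow> real \<Rightarrow> nat" where
  "cell L x = nat \<lfloor>real L * frac x\<rfloor>"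

lemma cell_less: "L > 0 \<Longrightarrow> cell L x < L"
  unfolding cell_def by (simp add: nat_less_iff frac_ge_0 floor_less_iff frac_lt_1)

lemma cell_bounds:
  "real (cell L x) \<le> real L * frac x" "real L * frac x < real (cell L x) + 1"
proof -
  have "real (nat \<lfloor>real L * frac x\<rfloor>) = of_int \<lfloor>real L * frac x\<rfloor>"
    by (simp add: frac_ge_0)
  then show "real (cell L x) \<le> real L * frac x" "real L * frac x < real (cell L x) + 1"
    unfolding cell_def by linarith+
qed

text \<open>The integer is given explicitly as a floor because, for slopes, it is later multiplied
  by the step number \<open>l\<close>.\<close>

lemma cell_close:
  assumes "L > 0"
  shows "\<bar>x - real (cell L x) / real L - \<lfloor>x\<rfloor>\<bar> \<le> 1 / real L"
proof -
  have "\<bar>real L * (frac x - real (cell L x) / real L)\<bar> \<le> 1"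
    using assms cell_bounds[of L x] by (simp add: right_diff_distrib abs_le_iff)
  then have "\<bar>frac x - real (cell L x) / real L\<bar> * real L \<le> 1"
    by (simp add: abs_mult mult.commute)
  then have "\<bar>frac x - real (cell L x) / real L\<bar> \<le> 1 / real L"
    using assms by (simp add: pos_le_divide_eq)
  moreover have "x - real (cell L x) / real L - \<lfloor>x\<rfloor> = frac x - real (cell L x) / real L"
    by (simp add: frac_def)
  ultimately show ?thesis by simp
qed

text \<open>Here \<open>w\<close> encodes the shift w/2^E, and dropping its last E-k bits gives its
  cell at scale 2^-k. Points in the same cell differ by at most its width, so a single
  \<open>w\<close> can serve every scale up to \<open>E\<close>.\<close>

lemma cell_div_imp_close:
  assumes "k \<le> E" "w div 2 ^ (E - k) = cell (2 ^ k) x"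
  shows "\<bar>x - real w / 2 ^ E - \<lfloor>x\<rfloor>\<bar> \<le> 1 / 2 ^ k"
proof -
  let ?c = "cell (2 ^ k) x"
  have "w = ?c * 2 ^ (E - k) + w mod 2 ^ (E - k)"
    using assms(2) by (metis div_mult_mod_eq)
  moreover have "w mod 2 ^ (E - k) < 2 ^ (E - k)" by simp
  ultimately have "?c * 2 ^ (E - k) \<le> w" "w < (?c + 1) * 2 ^ (E - k)"
    by (metis le_add1, simp, linarith)
  then have "real (?c * 2 ^ (E - k)) \<le> real w" "real w < real ((?c + 1) * 2 ^ (E - k))"
    by (simp_all only: of_nat_le_iff of_nat_less_iff)
  then have w: "real ?c * 2 ^ (E - k) \<le> real w" "real w < (real ?c + 1) * 2 ^ (E - k)"
    by (simp_all add: distrib_right)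
  have E: "(2::real) ^ E = 2 ^ k * 2 ^ (E - k)" using assms(1) by (simp flip: power_add)
  have "real ?c \<le> 2 ^ k * (real w / 2 ^ E)" "2 ^ k * (real w / 2 ^ E) < real ?c + 1"
    using w by (simp_all add: E field_simps)
  with cell_bounds[of "2 ^ k" x] have "\<bar>2 ^ k * (frac x - real w / 2 ^ E)\<bar> \<le> 1"
    by (simp add: right_diff_distrib abs_le_iff)
  then have "\<bar>frac x - real w / 2 ^ E\<bar> * 2 ^ k \<le> 1" by (simp add: abs_mult mult.commute)
  then have "\<bar>frac x - real w / 2 ^ E\<bar> \<le> 1 / 2 ^ k" by (simp add: pos_le_divide_eq)
  moreover have "x - real w / 2 ^ E - \<lfloor>x\<rfloor> = frac x - real w / 2 ^ E" by (simp add: frac_def)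
  ultimately show ?thesis by simp
qed

text \<open>A cell at scale \<open>k\<close> is a block of consecutive values, so a uniform
  \<open>w\<close> falls into a prescribed cell with probability exactly 2^-k.\<close>

lemma card_div_eq:
  fixes c :: nat
  assumes "k \<le> E" "c < 2 ^ k"
  shows "card {w\<in>{0..<2 ^ E}. w div 2 ^ (E - k) = c} = (2::nat) ^ (E - k)"
proof -
  have E: "(2::nat) ^ E = 2 ^ k * 2 ^ (E - k)" using assms(1) by (simp flip: power_add)
  have le: "(c + 1) * 2 ^ (E - k) \<le> (2::nat) ^ E"
    unfolding E using assms(2) by (intro mult_right_mono) auto
  have "w div 2 ^ (E - k) = c \<longleftrightarrow> c * 2 ^ (E - k) \<le> w \<and> w < (c + 1) * 2 ^ (E - k)" for w
  proof -
    have "w div 2 ^ (E - k) = c \<longleftrightarrow> c \<le> w div 2 ^ (E - k) \<and> w div 2 ^ (E - k) < c + 1" by linarith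
    then show ?thesis by (simp add: less_eq_div_iff_mult_less_eq div_less_iff_less_mult del: add_mult_distrib)
  qed
  then have "{w\<in>{0..<2 ^ E}. w div 2 ^ (E - k) = c} = {c * 2 ^ (E - k)..<(c + 1) * 2 ^ (E - k)}"
    using le by (intro set_eqI) (simp, linarith)
  then show ?thesis by simp
qed


section \<open>The union bound over scales and rounded progressions\<close>

text \<open>The left side counts scales, starts modulo \<open>M\<close>, rounded positions and
  rounded slopes in \<open>D\<close> coordinates. Its logarithm is linear in \<open>E\<close> with a
  coefficient quadratic in \<open>D\<close>. Since \<open>M\<close> contains \<open>c\<close>
  itself, \<open>c\<close> must also absorb its own logarithm.\<close>

lemma constraint_count_bound:
  fixes D E :: nat
  assumes "E \<ge> 1"
  defines "c \<equiv> 32 ^ (D + 1)"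
  defines "M \<equiv> 2 ^ (E * D) * c * E"
  shows "(E + 1) * (M * ((2 ^ E) ^ D * (2 ^ E * M) ^ D)) < (2::nat) ^ (c * E)"
proof -
  have E: "E + 1 \<le> 2 ^ E" "E \<le> 2 ^ E" using less_exp[of E] by (simp_all add: Suc_le_eq)
  have c2: "c = 2 ^ (5 * (D + 1))" unfolding c_def power_mult by simp
  have "M \<le> 2 ^ (E * D) * 2 ^ (5 * (D + 1)) * 2 ^ E"
    unfolding M_def c2 using E(2) by (intro mult_mono) auto
  also have "\<dots> = 2 ^ (E * (D + 1) + 5 * (D + 1))" by (simp add: power_add algebra_simps)
  also have "\<dots> \<le> 2 ^ (6 * E * (D + 1))"
  proof (rule power_increasing)
    have "1 * (D + 1) \<le> E * (D + 1)" using assms(1) by (intro mult_right_mono) auto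
    then show "E * (D + 1) + 5 * (D + 1) \<le> 6 * E * (D + 1)" by linarith
  qed simp
  finally have M: "M \<le> 2 ^ (6 * E * (D + 1))" .
  have "(E + 1) * (M * ((2 ^ E) ^ D * (2 ^ E * M) ^ D))
      \<le> 2 ^ E * (2 ^ (6 * E * (D + 1)) * ((2 ^ E) ^ D * (2 ^ E * 2 ^ (6 * E * (D + 1))) ^ D))"
    using E M by (intro mult_mono power_mono) auto
  also have "\<dots> = 2 ^ (E * (1 + 2 * D + 6 * (D + 1) ^ 2))"
    by (simp add: power_add[symmetric] power_mult[symmetric] algebra_simps power2_eq_square)
  also have "\<dots> < 2 ^ (c * E)"
  proof (rule power_strict_increasing)
    \<comment> \<open>The base 32 = 8 * 2 * 2 comes from bounding 8 by 8^(D+1) and each factor D+1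
      by 2^(D+1).\<close>
    have "(D + 1)\<^sup>2 \<le> (2 ^ (D + 1))\<^sup>2" using less_exp[of "D + 1"] by (intro power_mono) auto
    then have "8 * (D + 1) ^ 2 \<le> 8 ^ (D + 1) * (2 ^ (D + 1))\<^sup>2" by (intro mult_mono) auto
    also have "\<dots> = c" unfolding c_def power2_eq_square power_mult_distrib[symmetric] by simp
    finally have "8 * (D + 1) ^ 2 \<le> c" .
    moreover have "1 + 2 * D < 2 * (D + 1) ^ 2" by (simp add: power2_eq_square)
    ultimately have "1 + 2 * D + 6 * (D + 1) ^ 2 < c" by linarith
    then show "E * (1 + 2 * D + 6 * (D + 1) ^ 2) < c * E"
      unfolding mult.commute[of c] using assms(1) by (intro mult_strict_left_mono) auto
  qed simp
  finally show ?thesis .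
qed

text \<open>Choose \<open>N E\<close> random shifts and continue them periodically. With D =
  \<open>card J\<close>, a constraint at scale \<open>k\<close> gets \<open>N k\<close> independent
  trials, each failing with probability at most exp(-2^-(kD)), and the joint failure probability
  beats the number of constraints. The tolerance is three cell widths: rounding of \<open>p\<close>,
  accumulated rounding of \<open>v\<close>, and the cell shared with the shift.\<close>

lemma exists_shift_sequence:
  fixes J :: "'a set" and E :: nat
  assumes "finite J" "E \<ge> 1"
  defines "N \<equiv> \<lambda>k. 2 ^ (k * card J) * 32 ^ (card J + 1) * E"
  shows "\<exists>\<theta> :: int \<Rightarrow> 'a \<Rightarrow> real. \<forall>k\<le>E. \<forall>n p v. \<exists>l<N k. \<forall>a\<in>J. \<exists>z::int.
    \<bar>p a + real l * v a - \<theta> (n + int l) a - z\<bar> \<le> 3 / 2 ^ k"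
proof -
  define D c M where "D = card J" and "c = (32::nat) ^ (D + 1)" and "M = N E"
  define \<Omega> where "\<Omega> = PiE J (\<lambda>_. {0..<2 ^ E :: nat})"
  \<comment> \<open>The slope grid is finer than the position grid by the factor \<open>N k\<close>,
    so that fewer than \<open>N k\<close> steps accumulate an error of at most 2^-k.\<close>
  define target where "target = (\<lambda>k p v l (a::'a).
    cell (2 ^ k) (real (p a) / 2 ^ k + real l * (real (v a :: nat) / real (2 ^ k * N k))))"
  define hits where "hits = (\<lambda>(k, n, p, v) h. {\<omega>\<in>\<Omega>. \<exists>l<N k. (n + l) mod M = h \<and>
    (\<forall>a\<in>J. \<omega> a div 2 ^ (E - k) = target k p v l a)})"
  \<comment> \<open>The ranges at the finest scale contain those of every \<open>k \<le> E\<close>;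
    the surplus merely enlarges the count.\<close>
  define T where "T = {..E} \<times> {0..<M} \<times> PiE J (\<lambda>_. {0..<2 ^ E :: nat}) \<times> PiE J (\<lambda>_. {0..<2 ^ E * M})"
  have N_pos: "N k > 0" for k using assms(2) by (simp add: N_def)
  have M_pos: "M > 0" using N_pos by (simp add: M_def)
  have N_le: "N k \<le> M" if "k \<le> E" for k
    unfolding M_def N_def using that by (intro mult_right_mono power_increasing) auto
  have card_\<Omega>: "card \<Omega> = (2 ^ E) ^ D" unfolding \<Omega>_def D_def using assms(1) by (simp add: card_PiE)
  have fin_\<Omega>: "finite \<Omega>" unfolding \<Omega>_def using assms(1) by (intro finite_PiE) auto
  have fin_T: "finite T" unfolding T_def using assms(1) by (intro finite_cartesian_product finite_PiE) auto
  have card_T: "card T = (E + 1) * (M * ((2 ^ E) ^ D * (2 ^ E * M) ^ D))"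
    unfolding T_def D_def using assms(1) by (simp add: card_cartesian_product card_PiE)
  have hits_prob: "1 - real (card (hits (k, n, p, v) h)) / real (card \<Omega>) \<le> exp (- 1 / 2 ^ (k * D))"
    if "k \<le> E" "l < N k" "h = (n + l) mod M" for k n p v l h
  proof -
    let ?S = "PiE J (\<lambda>a. {w\<in>{0..<2 ^ E}. w div 2 ^ (E - k) = target k p v l a})"
    have "?S \<subseteq> hits (k, n, p, v) h"
      unfolding hits_def \<Omega>_def using that by (auto simp: PiE_iff)
    then have "card ?S \<le> card (hits (k, n, p, v) h)"
      by (rule card_mono[rotated]) (auto simp: hits_def intro: finite_subset[OF _ fin_\<Omega>])
    moreover have "card {w\<in>{0..<2 ^ E}. w div 2 ^ (E - k) = target k p v l a} = 2 ^ (E - k)" for a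
      by (rule card_div_eq[OF that(1)]) (simp add: target_def cell_less)
    then have "card ?S = (2 ^ (E - k)) ^ D"
      by (simp only: card_PiE[OF assms(1)] prod_constant D_def)
    ultimately have "real ((2 ^ (E - k)) ^ D) \<le> real (card (hits (k, n, p, v) h))"
      by (simp only: of_nat_le_iff)
    then have "real ((2 ^ (E - k)) ^ D) / real (card \<Omega>) \<le> real (card (hits (k, n, p, v) h)) / real (card \<Omega>)"
      by (rule divide_right_mono) simp
    moreover have "real ((2 ^ (E - k)) ^ D) / real (card \<Omega>) = 1 / 2 ^ (k * D)"
    proof -
      have "(2::real) ^ E = 2 ^ k * 2 ^ (E - k)" using that(1) by (simp flip: power_add)
      then show ?thesis by (simp add: card_\<Omega> power_mult_distrib power_mult)
    qed
    moreover have "1 + - 1 / 2 ^ (k * D) \<le> exp (- 1 / 2 ^ (k * D) :: real)" by (rule exp_ge_add_one_self)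
    ultimately show ?thesis by simp
  qed
  have prod_bound: "(\<Prod>h\<in>{0..<M}. 1 - real (card (hits t h)) / real (card \<Omega>)) \<le> exp (- real (c * E))"
    if "t \<in> T" for t
  proof -
    obtain k n p v where t: "t = (k, n, p, v)" by (metis prod.exhaust)
    have k: "k \<le> E" using that by (simp add: T_def t)
    define H where "H = (\<lambda>l. (n + l) mod M) ` {0..<N k}"
    \<comment> \<open>No two terms of one progression use the same random shift, so the trials are
      independent.\<close>
    have "inj_on (\<lambda>l. (n + l) mod M) {0..<N k}"
    proof (rule inj_onI)
      fix x y assume xy: "x \<in> {0..<N k}" "y \<in> {0..<N k}" "(n + x) mod M = (n + y) mod M"
      then have "x mod M = y mod M"
        unfolding nat_mod_eq_iff by auto
      then show "x = y" using xy N_le[OF k] by simp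
    qed
    then have card_H: "card H = N k" unfolding H_def by (simp add: card_image)
    have H_sub: "H \<subseteq> {0..<M}" using M_pos by (auto simp: H_def)
    have nonneg: "0 \<le> 1 - real (card (hits t h)) / real (card \<Omega>)" for h
    proof -
      have "card (hits t h) \<le> card \<Omega>"
        by (rule card_mono[OF fin_\<Omega>]) (auto simp: hits_def t)
      then show ?thesis by (simp add: divide_le_eq)
    qed
    have "(\<Prod>h\<in>{0..<M}. 1 - real (card (hits t h)) / real (card \<Omega>))
        \<le> (\<Prod>h\<in>{0..<M}. if h \<in> H then exp (- 1 / 2 ^ (k * D)) else 1)"
      using nonneg hits_prob[OF k] by (intro prod_mono) (auto simp: t H_def)
    also have "\<dots> = exp (- 1 / 2 ^ (k * D)) ^ N k"
      using H_sub by (simp add: prod.If_cases card_H Int_absorb1)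
    \<comment> \<open>\<open>N k\<close> is chosen so that N k / 2^(kD) equals \<open>c * E\<close>
      at every scale.\<close>
    also have "\<dots> = exp (- real (c * E))"
      by (simp add: N_def c_def D_def exp_of_nat_mult[symmetric])
    finally show ?thesis .
  qed
  have "(\<Sum>t\<in>T. \<Prod>h\<in>{0..<M}. 1 - real (card (hits t h)) / real (card \<Omega>))
      \<le> real (card T) * exp (- real (c * E))"
    using prod_bound by (rule sum_bounded_above)
  also have "\<dots> < 1"
  proof -
    have "card T < 2 ^ (c * E)"
      using constraint_count_bound[OF assms(2), of D]
      by (simp only: card_T c_def M_def N_def D_def)
    then have "real (card T) < real (2 ^ (c * E))" by (simp only: of_nat_less_iff)
    also have "\<dots> = 2 ^ (c * E)" by simp
    also have "\<dots> \<le> exp 1 ^ (c * E)"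
      using exp_ge_add_one_self[of 1] by (intro power_mono) auto
    also have "\<dots> = exp (real (c * E))" by (simp flip: exp_of_nat_mult)
    finally show ?thesis by (simp add: exp_minus field_simps)
  qed
  finally have small: "(\<Sum>t\<in>T. \<Prod>h\<in>{0..<M}. 1 - real (card (hits t h)) / real (card \<Omega>)) < 1" .
  have "\<Omega> \<noteq> {}" "\<And>t h. hits t h \<subseteq> \<Omega>"
    using card_\<Omega> by (auto simp: hits_def)
  from exists_hitting_assignment[OF _ fin_T fin_\<Omega> this small]
  obtain \<theta> where \<theta>: "\<And>t. t \<in> T \<Longrightarrow> \<exists>h\<in>{0..<M}. \<theta> h \<in> hits t h" by auto
  show ?thesis
  \<comment> \<open>The shifts lie on the grid of mesh 2^-E and are extended to all integers with
    period \<open>M\<close>.\<close>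
  proof (intro exI[of _ "\<lambda>m a. real (\<theta> (nat (m mod int M)) a) / 2 ^ E"] allI impI)
    fix k and n :: int and p v :: "'a \<Rightarrow> real"
    assume k: "k \<le> E"
    let ?L = "2 ^ k * N k"
    define n' p' v' where "n' = nat (n mod int M)"
      and "p' = restrict (\<lambda>a. cell (2 ^ k) (p a)) J" and "v' = restrict (\<lambda>a. cell ?L (v a)) J"
    have L: "?L > 0" "?L \<le> 2 ^ E * M" "(2::nat) ^ k \<le> 2 ^ E"
      using N_pos N_le[OF k] k by (auto intro!: mult_mono power_increasing)
    have "cell (2 ^ k) x < 2 ^ E" "cell ?L x < 2 ^ E * M" for x
      using less_le_trans[OF cell_less L(3)] less_le_trans[OF cell_less L(2)] L(1) by simp_all
    then have "(k, n', p', v') \<in> T"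
      unfolding T_def n'_def p'_def v'_def using k M_pos by (auto simp: nat_less_iff)
    from \<theta>[OF this] obtain l where l: "l < N k"
      "\<And>a. a \<in> J \<Longrightarrow> \<theta> ((n' + l) mod M) a div 2 ^ (E - k) = target k p' v' l a"
      by (auto simp: hits_def)
    have "int ((n' + l) mod M) = (n + int l) mod int M"
      using M_pos by (simp add: n'_def zmod_int mod_add_left_eq)
    then have idx: "nat ((n + int l) mod int M) = (n' + l) mod M" by (metis nat_int)
    show "\<exists>l<N k. \<forall>a\<in>J. \<exists>z::int.
      \<bar>p a + real l * v a - real (\<theta> (nat ((n + int l) mod int M)) a) / 2 ^ E - z\<bar> \<le> 3 / 2 ^ k"
    proof (intro exI[of _ l] conjI ballI l(1))
      fix a assume a: "a \<in> J"
      let ?w = "\<theta> ((n' + l) mod M) a"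
      define y where "y = real (p' a) / 2 ^ k + real l * (real (v' a) / real ?L)"
      have 1: "\<bar>y - real ?w / 2 ^ E - \<lfloor>y\<rfloor>\<bar> \<le> 1 / 2 ^ k"
        using l(2)[OF a] unfolding target_def y_def by (rule cell_div_imp_close[OF k])
      have 2: "\<bar>p a - real (p' a) / 2 ^ k - \<lfloor>p a\<rfloor>\<bar> \<le> 1 / 2 ^ k"
        using cell_close[of "2 ^ k" "p a"] a by (simp add: p'_def)
      have "\<bar>real l * (v a - real (v' a) / real ?L - \<lfloor>v a\<rfloor>)\<bar> \<le> real (N k) * (1 / real ?L)"
        unfolding abs_mult using cell_close[OF L(1), of "v a"] a l(1)
        by (intro mult_mono) (auto simp: v'_def)
      also have "\<dots> = 1 / 2 ^ k" using N_pos[of k] by simp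
      finally have 3: "\<bar>real l * v a - real l * (real (v' a) / real ?L) - real l * \<lfloor>v a\<rfloor>\<bar> \<le> 1 / 2 ^ k"
        by (simp only: right_diff_distrib)
      have "\<bar>p a + real l * v a - real ?w / 2 ^ E - (\<lfloor>y\<rfloor> + \<lfloor>p a\<rfloor> + int l * \<lfloor>v a\<rfloor>)\<bar> \<le> 3 / 2 ^ k"
        using 1 2 3 by (simp add: y_def abs_le_iff)
      then show "\<exists>z::int. \<bar>p a + real l * v a - real (\<theta> (nat ((n + int l) mod int M)) a) / 2 ^ E - z\<bar> \<le> 3 / 2 ^ k"
        unfolding idx by blast
    qed
  qed
qed


subsection \<open>Layers of shifted lattices\<close>

text \<open>Omitting the layer \<open>m = 0\<close> keeps the set at distance \<open>q\<close> from the origin, as finite density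
  requires for small balls.\<close>

definition shifted_layers :: "'n \<Rightarrow> real \<Rightarrow> (int \<Rightarrow> 'n \<Rightarrow> real) \<Rightarrow> (real ^ 'n) set" where
  "shifted_layers i q \<theta> =
     {x. \<exists>m. m \<noteq> 0 \<and> x $ i = q * of_int m \<and> (\<forall>c. c \<noteq> i \<longrightarrow> x $ c - \<theta> m c \<in> \<int>)}"

text \<open>Of two consecutive blocks of \<open>N\<close> multiples of \<open>q\<close> beyond
  \<open>a\<close>, one avoids 0. The two blocks and the rounding up of \<open>a / q\<close> account
  for the length q(2N+1).\<close>

lemma exists_nonzero_window:
  fixes a b q :: real
  assumes "q > 0" "b - a \<ge> q * (2 * real N + 1)"
  obtains n :: int where
    "\<And>l. l < N \<Longrightarrow> n + int l \<noteq> 0 \<and> a \<le> q * of_int (n + int l) \<and> q * of_int (n + int l) \<le> b"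
proof
  define n0 where "n0 = \<lceil>a / q\<rceil>"
  \<comment> \<open>The first block works if it starts after 0 or ends before it; otherwise 0 lies
    in it and the second block is positive.\<close>
  define n where "n = (if n0 > 0 \<or> n0 + int N \<le> 0 then n0 else n0 + int N)"
  fix l assume l: "l < N"
  have "a / q \<le> of_int n0" "of_int n0 < a / q + 1" unfolding n0_def by linarith+
  then have n0: "a \<le> q * of_int n0" "q * of_int n0 \<le> a + q"
    using assms(1) by (simp_all add: field_simps)
  have ge: "q * of_int n0 \<le> q * of_int (n + int l)"
    using assms(1) by (intro mult_left_mono) (auto simp: n_def)
  have "q * of_int (n + int l) \<le> q * (of_int n0 + 2 * real N)"
    using assms(1) l by (intro mult_left_mono) (auto simp: n_def)
  also have "\<dots> \<le> b" using n0(2) assms(2) by (simp add: algebra_simps)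
  finally show "n + int l \<noteq> 0 \<and> a \<le> q * of_int (n + int l) \<and> q * of_int (n + int l) \<le> b"
    using ge n0(1) l by (auto simp: n_def split: if_splits)
qed

text \<open>Where the segment meets the hyperplane x_i = q(n+l), its other coordinates are p + l v,
  so the hypothesis on \<open>\<theta>\<close> supplies a layer point within \<open>\<delta>\<close>
  in each coordinate. The l1 norm then bounds the Euclidean one, whence the factor
  \<open>CARD('n)\<close>.\<close>

lemma shifted_layers_hit:
  fixes a b :: "real ^ 'n::finite"
  assumes "q > 0" "\<delta> \<ge> 0" "b $ i - a $ i \<ge> q * (2 * real N + 1)"
    and \<theta>: "\<And>n p v. \<exists>l<N. \<forall>c\<in>-{i}. \<exists>z::int. \<bar>p c + real l * v c - \<theta> (n + int l) c - z\<bar> \<le> \<delta>"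
  shows "\<exists>x\<in>shifted_layers i q \<theta>. infdist x (closed_segment a b) \<le> real CARD('n) * \<delta>"
proof -
  obtain n where n: "\<And>l. l < N \<Longrightarrow>
      n + int l \<noteq> 0 \<and> a $ i \<le> q * of_int (n + int l) \<and> q * of_int (n + int l) \<le> b $ i"
    using exists_nonzero_window[OF assms(1,3)] by blast
  let ?w = "b $ i - a $ i"
  have "q * (2 * real N + 1) > 0" using assms(1) by (intro mult_pos_pos) auto
  then have w: "?w > 0" using assms(3) by linarith
  \<comment> \<open>\<open>p\<close> describes the crossing with the hyperplane of index
    \<open>n\<close>, and \<open>v\<close> the increment from one hyperplane to the next.\<close>
  define p v where "p c = a $ c + (b $ c - a $ c) * (q * of_int n - a $ i) / ?w"
    and "v c = (b $ c - a $ c) * q / ?w" for c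
  obtain l where l: "l < N" and "\<forall>c\<in>-{i}. \<exists>z::int. \<bar>p c + real l * v c - \<theta> (n + int l) c - z\<bar> \<le> \<delta>"
    using \<theta>[where p = p and v = v and n = n] by blast
  then obtain z :: "'n \<Rightarrow> int" where
    z: "\<And>c. c \<noteq> i \<Longrightarrow> \<bar>p c + real l * v c - \<theta> (n + int l) c - z c\<bar> \<le> \<delta>"
    by (metis ComplI singletonD)
  define m where "m = n + int l"
  define t where "t = (q * of_int m - a $ i) / ?w"
  define y where "y = a + t *\<^sub>R (b - a)"
  define x :: "real ^ 'n" where "x = (\<chi> c. if c = i then q * of_int m else \<theta> m c + z c)"
  have m: "m \<noteq> 0" "a $ i \<le> q * of_int m" "q * of_int m \<le> b $ i" using n[OF l] by (simp_all add: m_def)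
  have "0 \<le> t" "t \<le> 1" using m w by (simp_all add: t_def)
  then have y: "y \<in> closed_segment a b"
    unfolding y_def closed_segment_def by (auto intro!: exI[of _ t] simp: algebra_simps)
  have "\<bar>(x - y) $ c\<bar> \<le> \<delta>" for c
  proof (cases "c = i")
    case True
    have "t * ?w = q * of_int m - a $ i" using w by (simp add: t_def)
    then show ?thesis using True assms(2) by (simp add: x_def y_def)
  next
    case False
    have "y $ c = p c + real l * v c"
      using w by (simp add: y_def t_def p_def v_def m_def field_simps)
    then show ?thesis using z[OF False] False by (simp add: x_def m_def abs_minus_commute)
  qed
  then have "(\<Sum>c\<in>UNIV. \<bar>(x - y) $ c\<bar>) \<le> real CARD('n) * \<delta>" by (rule sum_bounded_above)
  then have "dist x y \<le> real CARD('n) * \<delta>" using norm_le_l1_cart[of "x - y"] by (simp add: dist_norm)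
  with y have "infdist x (closed_segment a b) \<le> real CARD('n) * \<delta>" by (rule infdist_le2)
  moreover have "x \<in> shifted_layers i q \<theta>"
    unfolding shifted_layers_def x_def using m(1) by (auto intro!: exI[of _ m])
  ultimately show ?thesis by blast
qed

section \<open>Counting layer points in balls\<close>

lemma finite_card_translated_ints:
  fixes s T :: real
  assumes "T \<ge> 0"
  shows "finite {x. \<bar>x\<bar> \<le> T \<and> x - s \<in> \<int>}" "real (card {x. \<bar>x\<bar> \<le> T \<and> x - s \<in> \<int>}) \<le> 2 * T + 1"
proof -
  let ?I = "{\<lceil>- T - s\<rceil>..\<lfloor>T - s\<rfloor>}"
  have sub: "{x. \<bar>x\<bar> \<le> T \<and> x - s \<in> \<int>} \<subseteq> (\<lambda>z. s + of_int z) ` ?I"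
  proof
    fix x assume "x \<in> {x. \<bar>x\<bar> \<le> T \<and> x - s \<in> \<int>}"
    then obtain z where "\<bar>x\<bar> \<le> T" "x - s = of_int z" by (auto elim: Ints_cases)
    then show "x \<in> (\<lambda>z. s + of_int z) ` ?I"
      by (intro image_eqI[of _ _ z]) (auto simp: ceiling_le_iff le_floor_iff abs_le_iff)
  qed
  show "finite {x. \<bar>x\<bar> \<le> T \<and> x - s \<in> \<int>}" by (rule finite_subset[OF sub]) simp
  have "card {x. \<bar>x\<bar> \<le> T \<and> x - s \<in> \<int>} \<le> card ((\<lambda>z. s + real_of_int z) ` ?I)"
    by (rule card_mono[OF _ sub]) simp
  also have "\<dots> \<le> card ?I" by (rule card_image_le) simp
  finally have "real (card {x. \<bar>x\<bar> \<le> T \<and> x - s \<in> \<int>}) \<le> real (card ?I)" by simp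
  also have "\<dots> \<le> 2 * T + 1"
  proof -
    have "of_int (\<lfloor>T - s\<rfloor> - \<lceil>- T - s\<rceil> + 1) \<le> 2 * T + 1" by linarith
    then show ?thesis using assms by (cases "\<lfloor>T - s\<rfloor> - \<lceil>- T - s\<rceil> + 1 \<ge> 0") (auto simp: of_nat_nat)
  qed
  finally show "real (card {x. \<bar>x\<bar> \<le> T \<and> x - s \<in> \<int>}) \<le> 2 * T + 1" .
qed

text \<open>A nonzero \<open>m\<close> forces |x_i| >= q, so a ball meets only families whose
  spacing is at most its radius.\<close>

lemma shifted_layers_far:
  fixes i :: "'n::finite"
  assumes "q > T"
  shows "cball 0 T \<inter> shifted_layers i q \<theta> = {}"
proof (rule ccontr)
  assume "\<not> ?thesis"
  then obtain x m where x: "norm x \<le> T" "m \<noteq> 0" "x $ i = q * of_int m"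
    by (auto simp: shifted_layers_def)
  have T: "0 \<le> T" using x(1) norm_ge_zero[of x] by linarith
  have "q * 1 \<le> q * \<bar>of_int m\<bar>" using x(2) T assms by (intro mult_left_mono) auto
  also have "\<dots> = \<bar>x $ i\<bar>" using T assms x(3) by (simp add: abs_mult)
  also have "\<dots> \<le> T" using component_le_norm_cart[of x i] x(1) by linarith
  finally show False using assms by simp
qed

text \<open>At most 2T/q layers are in reach, each with at most (2T+1)^(d-1) points, d being the
  dimension. Both bounds are relaxed to use 3T, where \<open>T \<ge> 1\<close> gives 2T+1 <= 3T, so
  that they combine into one power.\<close>

lemma card_shifted_layers:
  fixes i :: "'n::finite"
  assumes "q \<ge> 1" "T \<ge> q"
  shows "finite (cball 0 T \<inter> shifted_layers i q \<theta>)"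
    and "real (card (cball 0 T \<inter> shifted_layers i q \<theta>)) \<le> (3 * T) ^ CARD('n) / q"
proof -
  define f where "f = \<lfloor>T / q\<rfloor>"
  \<comment> \<open>Within the ball a layer lies in a product set; its factor in direction
    \<open>i\<close> is a single value, which saves one power of T.\<close>
  define B where "B m c = (if c = i then {q * of_int m} else {x. \<bar>x\<bar> \<le> T \<and> x - \<theta> m c \<in> \<int>})" for m c
  define S where "S = (\<Union>m\<in>{-f..f} - {0}. vec_lambda ` PiE UNIV (B m) :: (real ^ 'n) set)"
  have f: "1 \<le> f" "of_int f \<le> T / q" using assms by (simp_all add: f_def le_floor_iff)
  have sub: "cball 0 T \<inter> shifted_layers i q \<theta> \<subseteq> S"
  proof
    fix x assume "x \<in> cball 0 T \<inter> shifted_layers i q \<theta>"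
    then obtain m where x: "norm x \<le> T" "m \<noteq> 0" "x $ i = q * of_int m"
      "\<And>c. c \<noteq> i \<Longrightarrow> x $ c - \<theta> m c \<in> \<int>" by (auto simp: shifted_layers_def)
    have c: "\<bar>x $ c\<bar> \<le> T" for c using component_le_norm_cart[of x c] x(1) by linarith
    have "\<bar>of_int m\<bar> \<le> T / q"
      using c[of i] assms by (simp add: x(3) abs_mult field_simps)
    then have "m \<in> {-f..f} - {0}" using x(2) unfolding f_def by (simp add: abs_le_iff) linarith
    moreover have "x \<in> vec_lambda ` PiE UNIV (B m)"
      by (rule image_eqI[of _ _ "vec_nth x"]) (auto simp: B_def x c)
    ultimately show "x \<in> S" unfolding S_def by blast
  qed
  have T: "T \<ge> 1" using assms by simp
  have fin_B: "finite (B m c)" for m c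
    using finite_card_translated_ints(1)[of T "\<theta> m c"] T by (simp add: B_def)
  have fin_S: "finite S" unfolding S_def using fin_B by (intro finite_UN_I finite_imageI finite_PiE) auto
  show "finite (cball 0 T \<inter> shifted_layers i q \<theta>)" by (rule finite_subset[OF sub fin_S])
  have slice: "real (card (vec_lambda ` PiE UNIV (B m) :: (real ^ 'n) set)) \<le> (3 * T) ^ (CARD('n) - 1)" for m
  proof -
    have "card (vec_lambda ` PiE UNIV (B m) :: (real ^ 'n) set) \<le> card (PiE UNIV (B m))"
      using fin_B by (intro card_image_le finite_PiE) auto
    also have "\<dots> = (\<Prod>c\<in>UNIV. card (B m c))" by (simp add: card_PiE)
    also have "\<dots> = (\<Prod>c\<in>UNIV - {i}. card (B m c))"
      by (rule prod.mono_neutral_right) (auto simp: B_def)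
    finally have "real (card (vec_lambda ` PiE UNIV (B m) :: (real ^ 'n) set))
        \<le> (\<Prod>c\<in>UNIV - {i}. real (card (B m c)))" by (metis of_nat_le_iff of_nat_prod)
    also have "\<dots> \<le> (\<Prod>c\<in>UNIV - {i}. 3 * T)"
    proof (rule prod_mono)
      fix c assume "c \<in> UNIV - {i}"
      then show "0 \<le> real (card (B m c)) \<and> real (card (B m c)) \<le> 3 * T"
        using finite_card_translated_ints(2)[of T "\<theta> m c"] T by (simp add: B_def)
    qed
    also have "\<dots> = (3 * T) ^ (CARD('n) - 1)" by (simp add: card_Diff_singleton)
    finally show ?thesis .
  qed
  have "card (cball 0 T \<inter> shifted_layers i q \<theta>) \<le> card S" by (rule card_mono[OF fin_S sub])
  also have "\<dots> \<le> (\<Sum>m\<in>{-f..f} - {0}. card (vec_lambda ` PiE UNIV (B m) :: (real ^ 'n) set))"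
    unfolding S_def by (rule card_UN_le) simp
  finally have "real (card (cball 0 T \<inter> shifted_layers i q \<theta>))
      \<le> (\<Sum>m\<in>{-f..f} - {0}. real (card (vec_lambda ` PiE UNIV (B m) :: (real ^ 'n) set)))"
    by (metis of_nat_le_iff of_nat_sum)
  also have "\<dots> \<le> real (card ({-f..f} - {0})) * (3 * T) ^ (CARD('n) - 1)"
    using slice by (rule sum_bounded_above)
  also have "real (card ({-f..f} - {0})) = 2 * of_int f" using f(1) by (simp add: card_Diff_singleton)
  also have "2 * of_int f * (3 * T) ^ (CARD('n) - 1) \<le> (3 * T / q) * (3 * T) ^ (CARD('n) - 1)"
    using f T assms by (intro mult_right_mono) auto
  also have "\<dots> = (3 * T) ^ CARD('n) / q"
    using power_Suc[of "3 * T" "CARD('n) - 1"] by simp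
  finally show "real (card (cball 0 T \<inter> shifted_layers i q \<theta>)) \<le> (3 * T) ^ CARD('n) / q" .
qed

text \<open>Only families with \<open>q j \<le> T\<close> meet the ball, and their counts add up to
  a multiple of T^d times a partial sum of the series. The lower bound on \<open>q j\<close> makes
  these families finite in number and gives \<open>q j \<ge> 1\<close>.\<close>

lemma finite_density_UN_shifted_layers:
  fixes q :: "nat \<Rightarrow> real" and \<theta> :: "'n::finite \<Rightarrow> nat \<Rightarrow> int \<Rightarrow> 'n \<Rightarrow> real"
  assumes q: "\<And>j. real j + 1 \<le> q j" and sum: "summable (\<lambda>j. 1 / q j)"
  shows "finite_density (\<Union>i. \<Union>j. shifted_layers i (q j) (\<theta> i j))"
proof -
  define S where "S = (\<lambda>(i, j). shifted_layers i (q j) (\<theta> i j))"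
  define K where "K = real CARD('n) * 3 ^ CARD('n) * (\<Sum>j. 1 / q j)"
  have q_pos: "q j > 0" "q j \<ge> 1" for j using q[of j] by simp_all
  have "0 < (\<Sum>j. 1 / q j)" using q_pos by (intro suminf_pos sum) auto
  then have K: "K > 0" by (simp add: K_def)
  have "finite (cball 0 T \<inter> (\<Union>i. \<Union>j. shifted_layers i (q j) (\<theta> i j))) \<and>
     real (card (cball 0 T \<inter> (\<Union>i. \<Union>j. shifted_layers i (q j) (\<theta> i j)))) \<le> K * T ^ CARD('n)"
    if T: "T > 0" for T
  proof -
    define P where "P = (UNIV :: 'n set) \<times> {j. q j \<le> T}"
    have fin_J: "finite {j. q j \<le> T}"
    proof (rule finite_subset)
      show "{j. q j \<le> T} \<subseteq> {..nat \<lfloor>T\<rfloor>}"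
      proof
        fix j assume "j \<in> {j. q j \<le> T}"
        then have "real j \<le> T" using q[of j] by simp
        then show "j \<in> {..nat \<lfloor>T\<rfloor>}" by (simp add: le_nat_floor)
      qed
    qed simp
    have eq: "cball 0 T \<inter> (\<Union>i. \<Union>j. shifted_layers i (q j) (\<theta> i j)) = (\<Union>t\<in>P. cball 0 T \<inter> S t)"
    proof -
      have "q j \<le> T" if "x \<in> cball 0 T \<inter> shifted_layers i (q j) (\<theta> i j)" for x i j
        using that shifted_layers_far[of T "q j" i "\<theta> i j"] by (cases "q j \<le> T") auto
      then show ?thesis by (fastforce simp: S_def P_def)
    qed
    have fin_P: "finite P" using fin_J by (simp add: P_def)
    have bnd: "finite (cball 0 T \<inter> S t)" "real (card (cball 0 T \<inter> S t)) \<le> (3 * T) ^ CARD('n) * (1 / q (snd t))"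
      if "t \<in> P" for t
      using that card_shifted_layers[of "q (snd t)" T "fst t" "\<theta> (fst t) (snd t)"] q_pos
      by (auto simp: P_def S_def split: prod.splits)
    have "card (\<Union>t\<in>P. cball 0 T \<inter> S t) \<le> (\<Sum>t\<in>P. card (cball 0 T \<inter> S t))"
      by (rule card_UN_le[OF fin_P])
    then have "real (card (\<Union>t\<in>P. cball 0 T \<inter> S t)) \<le> (\<Sum>t\<in>P. real (card (cball 0 T \<inter> S t)))"
      by (metis of_nat_le_iff of_nat_sum)
    also have "\<dots> \<le> (\<Sum>t\<in>P. (3 * T) ^ CARD('n) * (1 / q (snd t)))" by (rule sum_mono) (rule bnd)
    also have "\<dots> = (\<Sum>i\<in>(UNIV :: 'n set). \<Sum>j\<in>{j. q j \<le> T}. (3 * T) ^ CARD('n) * (1 / q j))"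
      unfolding P_def sum.cartesian_product by (simp add: case_prod_beta)
    also have "\<dots> = real CARD('n) * (3 * T) ^ CARD('n) * (\<Sum>j\<in>{j. q j \<le> T}. 1 / q j)"
      by (simp add: sum_distrib_left mult.assoc)
    also have "\<dots> \<le> real CARD('n) * (3 * T) ^ CARD('n) * (\<Sum>j. 1 / q j)"
      using q_pos T by (intro mult_left_mono sum_le_suminf[OF sum fin_J]) (auto simp: less_imp_le)
    also have "\<dots> = K * T ^ CARD('n)" by (simp add: K_def power_mult_distrib)
    finally have "real (card (\<Union>t\<in>P. cball 0 T \<inter> S t)) \<le> K * T ^ CARD('n)" .
    moreover have "finite (\<Union>t\<in>P. cball 0 T \<inter> S t)"
      using fin_P bnd(1) by (rule finite_UN_I)
    ultimately show ?thesis unfolding eq by blast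
  qed
  with K show ?thesis unfolding finite_density_def by blast
qed


subsection \<open>The dense forest\<close>

text \<open>The Euclidean norm is at most the l1 norm, hence at most the dimension times the largest
  coordinate.\<close>

lemma exists_large_coordinate:
  fixes u :: "real ^ 'n::finite"
  shows "\<exists>i. norm u \<le> real CARD('n) * \<bar>u $ i\<bar>"
proof (rule ccontr)
  assume "\<not> ?thesis"
  then have "\<bar>u $ i\<bar> < norm u / real CARD('n)" for i
    by (simp add: not_le pos_less_divide_eq mult.commute)
  then have "(\<Sum>i\<in>UNIV. \<bar>u $ i\<bar>) < real CARD('n) * (norm u / real CARD('n))"
    by (intro sum_bounded_above_strict) auto
  then show False using norm_le_l1_cart[of u] by simp
qed

text \<open>Take the integer parts of \<open>x\<close> and of log2 k. Block \<open>j\<close>, built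
  with \<open>E = 2 ^ (j + 1)\<close>, then covers scale \<open>k\<close> while \<open>E\<close>
  stays at most 2k, so its cost is comparable to \<open>x\<close>.\<close>

lemma exists_dyadic_block:
  assumes "x \<ge> 1"
  obtains k j :: nat where "real k \<le> x" "x < real k + 1" "2 ^ j \<le> k" "k \<le> 2 ^ (j + 1)"
    "real j \<le> log 2 x"
proof -
  define k where "k = nat \<lfloor>x\<rfloor>"
  have "real k = of_int \<lfloor>x\<rfloor>" using assms by (simp add: k_def)
  then have k: "real k \<le> x" "x < real k + 1" by linarith+
  have "1 \<le> k" using assms by (simp add: k_def le_nat_floor)
  obtain j where j: "2 ^ j \<le> k" "k < 2 ^ (j + 1)" using ex_power_ivl1[of 2 k] \<open>1 \<le> k\<close> by auto
  have "2 powr real j = real (2 ^ j)" by (simp add: powr_realpow)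
  also have "\<dots> \<le> x" using j(1) k(1) by (metis of_nat_le_iff order_trans)
  finally have "real j \<le> log 2 x" using assms by (simp add: le_log_iff)
  with k j show ?thesis using that by auto
qed

theorem corollary1p0p1:
  fixes \<eta> :: real
  assumes "CARD('n::finite) \<ge> 2" and "\<eta> > 0"
  shows "\<exists>(F :: (real ^ 'n) set) (W :: real \<Rightarrow> real). dense_forest F W \<and>
    (\<exists>C>0. \<exists>\<epsilon>\<^sub>0\<in>{0<..<exp (-1)}. \<forall>\<epsilon>\<in>{0<..\<epsilon>\<^sub>0}.
       W \<epsilon> \<le> C * \<epsilon> powr (- (real CARD('n) - 1)) * ln (1 / \<epsilon>) * ln (ln (1 / \<epsilon>)) powr (1 + \<eta>))"
proof -
  define d where "d = real CARD('n)"
  have d: "d \<ge> 2" using assms(1) by (simp add: d_def)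
  define q where "q j = (real j + 1) powr (1 + \<eta>)" for j :: nat
  \<comment> \<open>The length from \<open>exists_shift_sequence\<close> for
    \<open>E = 2 ^ (j + 1)\<close> and d-1 free coordinates.\<close>
  define N where "N j k = 2 ^ (k * (CARD('n) - 1)) * 32 ^ CARD('n) * (2::nat) ^ (j + 1)" for j k :: nat
  have q_ge: "real j + 1 \<le> q j" for j
    using powr_mono[of 1 "1 + \<eta>" "real j + 1"] assms(2) by (simp add: q_def)
  have q_pos: "q j > 0" for j by (simp add: q_def)
  define good where "good i j \<theta> \<longleftrightarrow> (\<forall>k\<le>2 ^ (j + 1). \<forall>n p v. \<exists>l<N j k. \<forall>c\<in>-{i}. \<exists>z::int.
      \<bar>p c + real l * v c - \<theta> (n + int l) c - z\<bar> \<le> 3 / 2 ^ k)" for i :: 'n and j \<theta>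
  have "\<exists>\<theta>. good i j \<theta>" for i j
  proof -
    have "card (-{i}) = CARD('n) - 1" by (simp add: Compl_eq_Diff_UNIV card_Diff_singleton)
    then show ?thesis
      using exists_shift_sequence[of "-{i}" "2 ^ (j + 1)"] assms(1) by (simp add: good_def N_def)
  qed
  then obtain \<theta> where "\<And>i j. good i j (\<theta> i j)" by metis
  then have \<theta>: "\<exists>l<N j k. \<forall>c\<in>-{i}. \<exists>z::int. \<bar>p c + real l * v c - \<theta> i j (n + int l) c - z\<bar> \<le> 3 / 2 ^ k"
    if "k \<le> 2 ^ (j + 1)" for i j k n p v
    using that unfolding good_def by blast
  define F where "F = (\<Union>i. \<Union>j. shifted_layers i (q j) (\<theta> i j))"
  \<comment> \<open>\<open>U x\<close> dominates the length needed at the scale \<open>2\<^bsup>-k\<^esup>\<close> with \<open>k = \<lfloor>x\<rfloor>\<close>; real \<open>x\<close> makes \<open>W\<close> monotone.\<close>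
  define U where "U x = 6 * 32 ^ CARD('n) * d * (2 powr (x * (d - 1)) * (x * (log 2 x + 1) powr (1 + \<eta>)))"
    for x :: real
  \<comment> \<open>Rounding the logarithm down to \<open>k\<close> loses at most a factor 2, so 2^k
    is still at least 3d/\<open>\<epsilon>\<close>, as the tolerance d * 3/2^k requires.\<close>
  define W where "W \<epsilon> = U (log 2 (6 * d / \<epsilon>))" for \<epsilon> :: real

  \<comment> \<open>Finite density of \<open>F\<close> and the shape of \<open>W\<close>\<close>
  have summable_q: "summable (\<lambda>j. 1 / q j)"
  proof -
    have "summable (\<lambda>j. real j powr (- (1 + \<eta>)))" using assms(2) by (simp add: summable_real_powr_iff)
    then have "summable (\<lambda>j. real (Suc j) powr (- (1 + \<eta>)))" by (subst summable_Suc_iff)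
    then show ?thesis unfolding q_def powr_minus_divide[symmetric] by (simp add: add.commute)
  qed
  have density: "finite_density F"
    unfolding F_def using q_ge summable_q by (rule finite_density_UN_shifted_layers)

  \<comment> \<open>All factors of \<open>U x\<close> other than \<open>x\<close> are at least 1;
    this yields both positivity and divergence of \<open>W\<close>.\<close>
  have U_ge: "x \<le> U x" if "x \<ge> 1" for x
  proof -
    have "1 * (1 * (x * 1)) \<le> U x"
      unfolding U_def using that d assms(2)
      by (intro mult_mono ge_one_powr_ge_zero mult_ge1_I) (auto simp: mult_ge1_I)
    then show ?thesis by simp
  qed
  have U_mono: "U x \<le> U y" if "1 \<le> x" "x \<le> y" for x y
    unfolding U_def using that d assms(2)
    by (intro mult_mono powr_mono powr_mono2 mult_right_mono add_mono) auto
  have arg_ge: "log 2 (6 * d / \<epsilon>) \<ge> 1" if "\<epsilon> \<in> {0<..<1}" for \<epsilon>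
    using that d by (simp add: le_log_iff field_simps)

  have W_pos: "\<forall>\<epsilon>\<in>{0<..<1}. W \<epsilon> > 0"
    using U_ge arg_ge unfolding W_def by (meson less_le_trans zero_less_one)
  have W_anti: "antimono_on {0<..<1} W"
  proof (rule monotone_onI)
    fix \<epsilon> \<epsilon>' :: real assume e: "\<epsilon> \<in> {0<..<1}" "\<epsilon>' \<in> {0<..<1}" "\<epsilon> \<le> \<epsilon>'"
    have "log 2 (6 * d / \<epsilon>') \<le> log 2 (6 * d / \<epsilon>)"
      using e d by (subst log_le_cancel_iff) (auto intro!: divide_left_mono)
    then show "W \<epsilon>' \<le> W \<epsilon>" unfolding W_def using arg_ge[OF e(2)] by (rule U_mono[rotated])
  qed
  have W_lim: "filterlim W at_top (at_right 0)"
  proof (rule filterlim_at_top_mono)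
    show "filterlim (\<lambda>\<epsilon>. log 2 (6 * d / \<epsilon>)) at_top (at_right 0)"
      using d by real_asymp
    show "\<forall>\<^sub>F \<epsilon> in at_right 0. log 2 (6 * d / \<epsilon>) \<le> W \<epsilon>"
      unfolding W_def eventually_at_right_field
      using U_ge arg_ge by (intro exI[of _ 1]) auto
  qed

  \<comment> \<open>Visibility\<close>
  have visible: "\<exists>x\<in>F. infdist x (closed_segment a b) \<le> \<epsilon>"
    if \<epsilon>: "\<epsilon> \<in> {0<..<1}" and ab: "dist a b = W \<epsilon>" for \<epsilon> and a b :: "real ^ 'n"
  proof -
    define x where "x = log 2 (6 * d / \<epsilon>)"
    have x: "x \<ge> 1" unfolding x_def by (rule arg_ge[OF \<epsilon>])
    obtain k j where kj: "real k \<le> x" "x < real k + 1" "2 ^ j \<le> k" "k \<le> 2 ^ (j + 1)" "real j \<le> log 2 x"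
      using exists_dyadic_block[OF x] .
    have x_powr: "2 powr x = 6 * d / \<epsilon>" using \<epsilon> d by (simp add: x_def)
    have "6 * d / \<epsilon> \<le> 2 powr (real k + 1)"
      unfolding x_powr[symmetric] using kj(2) by (intro powr_mono) auto
    also have "\<dots> = 2 * 2 ^ k" by (simp add: powr_add powr_realpow)
    finally have tol: "d * (3 / 2 ^ k) \<le> \<epsilon>" using \<epsilon> by (simp add: field_simps)

    have "(2::real) ^ (k * (CARD('n) - 1)) = 2 powr (real k * (d - 1))"
      using assms(1) by (simp add: d_def of_nat_diff flip: powr_realpow)
    then have N: "real (N j k) = 2 powr (real k * (d - 1)) * 32 ^ CARD('n) * (2 * 2 ^ j)"
      by (simp add: N_def)
    have "0 < N j k" by (simp add: N_def)
    \<comment> \<open>The 3 absorbs the extra 1; together with 2 * 2^j <= 2x it produces the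
      constant 6 in \<open>U\<close>.\<close>
    then have "2 * real (N j k) + 1 \<le> 3 * real (N j k)" by linarith
    also have "\<dots> \<le> 3 * (2 powr (x * (d - 1)) * 32 ^ CARD('n) * (2 * x))"
    proof -
      have "(2::real) ^ j \<le> real k" using kj(3) by (metis of_nat_le_iff of_nat_numeral of_nat_power)
      then have "2 ^ j \<le> x" using kj(1) by (rule order_trans)
      then show ?thesis unfolding N using kj(1) d by (intro mult_mono powr_mono) auto
    qed
    finally have "2 * real (N j k) + 1 \<le> 6 * 32 ^ CARD('n) * (2 powr (x * (d - 1)) * x)" by (simp add: mult_ac)
    moreover have "q j \<le> (log 2 x + 1) powr (1 + \<eta>)"
      unfolding q_def using kj(5) assms(2) by (intro powr_mono2) auto
    ultimately have "q j * (2 * real (N j k) + 1)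
        \<le> (log 2 x + 1) powr (1 + \<eta>) * (6 * 32 ^ CARD('n) * (2 powr (x * (d - 1)) * x))"
      by (intro mult_mono) auto
    \<comment> \<open>The factor \<open>d\<close> in \<open>U\<close> pays for keeping only the
      dominant coordinate of the segment.\<close>
    also have "\<dots> = W \<epsilon> / d" using d by (simp add: W_def U_def x_def)
    finally have len: "q j * (2 * real (N j k) + 1) \<le> W \<epsilon> / d" .

    obtain i where "norm (b - a) \<le> d * \<bar>(b - a) $ i\<bar>"
      using exists_large_coordinate unfolding d_def by blast
    then have i: "W \<epsilon> / d \<le> \<bar>b $ i - a $ i\<bar>"
      using d ab by (simp add: dist_norm norm_minus_commute divide_le_eq mult.commute)
    have hit: "\<exists>x\<in>F. infdist x (closed_segment a' b') \<le> \<epsilon>"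
      if "b' $ i - a' $ i \<ge> W \<epsilon> / d" for a' b' :: "real ^ 'n"
    proof -
      have "\<exists>x\<in>shifted_layers i (q j) (\<theta> i j). infdist x (closed_segment a' b') \<le> real CARD('n) * (3 / 2 ^ k)"
        using len that by (intro shifted_layers_hit[where N = "N j k"] q_pos \<theta>[OF kj(4)]) auto
      then show ?thesis using tol unfolding F_def d_def by (meson UN_I UNIV_I order_trans)
    qed
    show ?thesis
    \<comment> \<open>Layers are met by segments increasing in coordinate \<open>i\<close>; others
      are reversed first.\<close>
    proof (cases "b $ i - a $ i \<ge> 0")
      case True
      then show ?thesis using i hit[of b a] by simp
    next
      case False
      then show ?thesis using i hit[of a b] by (simp add: closed_segment_commute)
    qed
  qed

  \<comment> \<open>The asymptotic bound on \<open>W\<close>\<close>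
  define K where "K = 6 * 32 ^ CARD('n) * d * ((6 * d) powr (d - 1) * (4 * 4 powr (1 + \<eta>)))"
  \<comment> \<open>Both ratios below tend to 1/ln 2 < 4. So 4 bounds them eventually, and it enters
    \<open>K\<close> once linearly and once to the power \<open>1 + \<eta>\<close>.\<close>
  have ln2: "inverse (ln 2) < (4::real)" using ln2_ge_two_thirds by (simp add: inverse_eq_divide divide_less_eq)
  have "((\<lambda>\<epsilon>. log 2 (6 * d / \<epsilon>) / ln (1 / \<epsilon>)) \<longlongrightarrow> inverse (ln 2)) (at_right 0)"
    using d by real_asymp
  from order_tendstoD(2)[OF this ln2]
  have "\<forall>\<^sub>F \<epsilon> in at_right 0. log 2 (6 * d / \<epsilon>) / ln (1 / \<epsilon>) < 4" .
  moreover have "((\<lambda>\<epsilon>. (log 2 (log 2 (6 * d / \<epsilon>)) + 1) / ln (ln (1 / \<epsilon>))) \<longlongrightarrow> inverse (ln 2)) (at_right 0)"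
    using d by real_asymp
  from order_tendstoD(2)[OF this ln2]
  have "\<forall>\<^sub>F \<epsilon> in at_right 0. (log 2 (log 2 (6 * d / \<epsilon>)) + 1) / ln (ln (1 / \<epsilon>)) < 4" .
  moreover have "\<forall>\<^sub>F \<epsilon>::real in at_right 0. \<epsilon> < exp (-1)"
    unfolding eventually_at_right_field by (intro exI[of _ "exp (-1)"]) auto
  moreover have "\<forall>\<^sub>F \<epsilon>::real in at_right 0. ln (ln (1 / \<epsilon>)) > 0" by real_asymp
  ultimately have "\<forall>\<^sub>F \<epsilon> in at_right 0. \<epsilon> < exp (-1) \<and> W \<epsilon> \<le>
      K * \<epsilon> powr (- (d - 1)) * ln (1 / \<epsilon>) * ln (ln (1 / \<epsilon>)) powr (1 + \<eta>)"
    using eventually_at_right_less[of "0::real"]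
  proof eventually_elim
    case (elim \<epsilon>)
    define x where "x = log 2 (6 * d / \<epsilon>)"
    have "exp (-1) < (1::real)" by simp
    then have e: "0 < \<epsilon>" "\<epsilon> < 1" using elim by linarith+
    then have x1: "x \<ge> 1" unfolding x_def by (intro arg_ge) auto
    have l1: "0 < ln (1 / \<epsilon>)" using e by (intro ln_gt_zero) simp
    have x_le: "x \<le> 4 * ln (1 / \<epsilon>)" "log 2 x + 1 \<le> 4 * ln (ln (1 / \<epsilon>))"
      using elim(1,2) unfolding x_def pos_divide_less_eq[OF elim(4)] pos_divide_less_eq[OF l1]
      by linarith+
    have "W \<epsilon> \<le> 6 * 32 ^ CARD('n) * d * (2 powr (x * (d - 1)) *
        ((4 * ln (1 / \<epsilon>)) * (4 * ln (ln (1 / \<epsilon>))) powr (1 + \<eta>)))"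
      unfolding W_def U_def x_def[symmetric] using x_le x1 d assms(2)
      by (intro mult_left_mono mult_mono powr_mono2) auto
    also have "2 powr (x * (d - 1)) = (6 * d) powr (d - 1) * \<epsilon> powr (- (d - 1))"
    proof -
      have "2 powr (x * (d - 1)) = (6 * d / \<epsilon>) powr (d - 1)"
        using e d by (simp add: x_def flip: powr_powr)
      also have "\<dots> = (6 * d) powr (d - 1) / \<epsilon> powr (d - 1)" by (rule powr_divide)
      finally show ?thesis unfolding powr_minus_divide by simp
    qed
    also have "(4 * ln (ln (1 / \<epsilon>))) powr (1 + \<eta>) = 4 powr (1 + \<eta>) * ln (ln (1 / \<epsilon>)) powr (1 + \<eta>)"
      by (rule powr_mult)
    finally show ?case using elim(3) by (simp add: K_def mult_ac)
  qed
  then obtain b where b: "b > 0" "\<And>\<epsilon>. 0 < \<epsilon> \<Longrightarrow> \<epsilon> < b \<Longrightarrow> \<epsilon> < exp (-1) \<and> W \<epsilon> \<le>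
      K * \<epsilon> powr (- (d - 1)) * ln (1 / \<epsilon>) * ln (ln (1 / \<epsilon>)) powr (1 + \<eta>)"
    unfolding eventually_at_right_field by blast
  have "K > 0" using d by (simp add: K_def)
  \<comment> \<open>Halving \<open>b\<close> fits an interval closed at its right end into the open
    range just obtained.\<close>
  moreover have "b / 2 \<in> {0<..<exp (-1)}" using b(1) b(2)[of "b / 2"] by simp
  moreover have "\<forall>\<epsilon>\<in>{0<..b / 2}. W \<epsilon> \<le>
      K * \<epsilon> powr (- (d - 1)) * ln (1 / \<epsilon>) * ln (ln (1 / \<epsilon>)) powr (1 + \<eta>)"
    using b by auto
  moreover have "dense_forest F W"
    unfolding dense_forest_def using density W_pos W_anti W_lim visible by blast
  ultimately show ?thesis unfolding d_def by blast
qed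

end
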